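(* Let $\Sigma$, $\Gamma$, a data stream $\mathbf D$, a time point $t\geq 1$ and a stream logic program $\mathcal P$ be as in the context. Then every $\Phi_{\mathcal P,\mathbf D,t}$-answer stream is a $t$-answer stream of $\mathcal P$ (for $\mathbf D$).
   Context: $\Sigma$ is a finite nonempty set of propositional atoms containing a special symbol $\top$. Formulas are given by the grammar $\alpha::=a\mid\neg\alpha\mid\alpha\land\alpha\mid\alpha\lor\alpha\mid\alpha\rightarrow\alpha\mid\Diamond\alpha\mid\Box\alpha\mid @_{t'}\alpha\mid\boxplus_{[\ell,r]}\alpha$ with $a\in\Sigma$, integer $t'\geq1$, $\ell,r\in\mathbb N\cup\{\infty\}$, $\ell\leq r$. A formula is normal if it contains none of $\neg,\lor,\rightarrow,\Diamond$. A stream is an infinite sequence $\mathbf I=I_1I_2\ldots$ with $I_s\subseteq\Sigma$ for all $s\geq1$; $\mathbf J\subseteq\mathbf I$ means $J_s\subseteq I_s$ for all $s$, and unions/differences are pointwise; $\emptyset$ denotes the stream with all components empty, and $\{a\}_s$ the stream with $\{a\}$ at time $s$ and $\emptyset$ elsewhere. The support $\mathrm{supp}\,\mathbf I$ is the tightest interval of time points containing $\{s\mid I_s\neq\emptyset\}$, and $\mathrm{supp}\,\emptyset=\emptyset$. For $\ell,r,s$, the window $\mathbf I[\ell,r;s]$ is the stream agreeing with $\mathbf I$ at time points $u$ with $s-\ell\leq u\leq s+r$ and empty elsewhere. Fix $\Gamma\subseteq\Sigma$ (background data). Entailment $\mathbf I,s\models_\Gamma\alpha$: always $\mathbf I,s\models_\Gamma\top$;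 for $a\neq\top$, $\mathbf I,s\models_\Gamma a$ iff $a\in I_s\cup\Gamma$; $\neg,\land,\lor,\rightarrow$ classically; $\mathbf I,s\models_\Gamma\Diamond\alpha$ iff $\mathbf I,s'\models_\Gamma\alpha$ for some $s'\in\mathrm{supp}\,\mathbf I$; $\mathbf I,s\models_\Gamma\Box\alpha$ iff $\mathbf I,s'\models_\Gamma\alpha$ for all $s'\in\mathrm{supp}\,\mathbf I$; $\mathbf I,s\models_\Gamma @_{s'}\alpha$ iff $\mathbf I,s'\models_\Gamma\alpha$; $\mathbf I,s\models_\Gamma\boxplus_{[\ell,r]}\alpha$ iff $\mathbf I[\ell,r;s],s\models_\Gamma\alpha$. Then $\mathbf I$ is an $s$-model of $\alpha$. A formula is $s$-consistent if it has an $s$-model; a normal $s$-formula is an $s$-consistent normal formula. A finite set of formulas is read as their conjunction. Partial model operator (for normal formulas): $\mathrm M_{\mathbf I,s}(a)=\{a\}_s$ if $a\notin\Gamma$ and $=\emptyset$ if $a\in\Gamma$; $\mathrm M_{\mathbf I,s}(\alpha\land\beta)=\mathrm M_{\mathbf I,s}(\alpha)\cup\mathrm M_{\mathbf I,s}(\beta)$; $\mathrm M_{\mathbf I,s}(\Box\alpha)=\bigcup_{s'\in\mathrm{supp}\,\mathbf I}\mathrm M_{\mathbf I,s'}(\alpha)$; $\mathrm M_{\mathbf I,s}(@_{s'}\alpha)=\mathrm M_{\mathbf I,s'}(\alpha)$; $\mathrm M_{\mathbf I,s}(\boxplus_{[\ell,r]}\alpha)=\mathrm M_{\mathbf I[\ell,r;s],s}(\alpha)$.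 For a finite set $A$ of normal formulas, $\mathrm M_{\mathbf I,s}(A)=\bigcup_{\alpha\in A}\mathrm M_{\mathbf I,s}(\alpha)$ ($=\emptyset$ if $A=\emptyset$). The model operator is $\mathrm{MM}_{\mathbf I,s}(X)=\mathrm M_{\mathrm M_{\mathbf I,s}(X),s}(X)$ for $X$ a normal formula or finite set of normal formulas. A program $\mathcal P$ is a finite nonempty set of rules $\rho$ of the form $\alpha\leftarrow\beta_1,\ldots,\beta_j,{\sim}\beta_{j+1},\ldots,{\sim}\beta_k$ ($k\geq j\geq1$) with $\alpha$ a normal formula, assumed $t$-consistent, and $\beta_i$ formulas; $\mathrm H(\rho)=\alpha$, $\mathrm B(\rho)=\beta_1\land\cdots\land\beta_j\land\neg\beta_{j+1}\land\cdots\land\neg\beta_k$. A data stream $\mathbf D$ is fixed. A stream $\mathbf I$ is a $t$-model of $\mathcal P$ (for $\mathbf D$) if $\mathbf D\subseteq\mathbf I$ and $\mathbf I,t\models_\Gamma\mathrm B(\rho)\rightarrow\mathrm H(\rho)$ for all $\rho\in\mathcal P$. The reduct is $\mathcal P^{\mathbf I,t}=\{\rho\in\mathcal P\mid\mathbf I,t\models_\Gamma\mathrm B(\rho)\}$. A stream $\mathbf I\supseteq\mathbf D$ is a $t$-answer stream of $\mathcal P$ (for $\mathbf D$) if it is a $t$-model of $\mathcal P^{\mathbf I,t}$ for $\mathbf D$ and no $t$-model $\mathbf J$ of $\mathcal P^{\mathbf I,t}$ for $\mathbf D$ satisfies $\mathbf J\subsetneq\mathbf I$. A 3-valued stream is a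 pair $(\mathbf I,\mathbf J)$ of streams with $\mathbf I\subseteq\mathbf J$; $[\mathbf I,\mathbf J]=\{\mathbf K\mid\mathbf I\subseteq\mathbf K\subseteq\mathbf J\}$; $(\mathbf I,\mathbf J),t\models_\Gamma\alpha$ iff $\mathbf K,t\models_\Gamma\alpha$ for every $\mathbf K\in[\mathbf I,\mathbf J]$. The Fitting operator is $\Phi_{\mathcal P,\mathbf D,t}(\mathbf I,\mathbf J)=\mathbf D\cup\mathrm{MM}_{\mathbf I,t}(\{\mathrm H(\rho)\mid\rho\in\mathcal P,\ (\mathbf I,\mathbf J),t\models_\Gamma\mathrm B(\rho)\})$. For a $t$-model $\mathbf I$ of $\mathcal P$, $\Phi^{\uparrow}_{\mathcal P,\mathbf D,t}(\mathbf I)$ is the least fixed point of the map $\mathbf K\mapsto\Phi_{\mathcal P,\mathbf D,t}(\mathbf K,\mathbf I)$ on the complete lattice $\{\mathbf K\mid\mathbf K\subseteq\mathbf I\}$. A $t$-model $\mathbf I$ of $\mathcal P$ (for $\mathbf D$) is a $\Phi_{\mathcal P,\mathbf D,t}$-answer stream if $\Phi^{\uparrow}_{\mathcal P,\mathbf D,t}(\mathbf I)=\mathbf I$.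
   Formalization: The partial model of the atom ⊤ is taken to be the empty stream even when ⊤ ∉ Γ (instead of {⊤}_s); with the literal clause the claim fails for the program {⊤ ← ⊤} with Γ = ∅ and D = ∅. *)

theory Defs
  imports Main "HOL-Library.Extended_Nat"
begin

(* The finite set of atoms is a type 'a of class finite; its special symbol is the
   argument tp of the definitions below. *)

typedef time = "{n::nat. 1 \<le> n}"
  morphisms nat_of_time time_of_nat
  by auto

datatype 'a formula =
    Atom 'a
  | Neg "'a formula"
  | Conj "'a formula" "'a formula"
  | Disj "'a formula" "'a formula"
  | Impl "'a formula" "'a formula"
  | Dia "'a formula"
  | Box "'a formula"
  | At time "'a formula"
  | Win enat enat "'a formula"

primrec wf_formula :: "'a formula \<Rightarrow> bool" where
  "wf_formula (Atom a) \<longleftrightarrow> True"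
| "wf_formula (Neg \<alpha>) \<longleftrightarrow> wf_formula \<alpha>"
| "wf_formula (Conj \<alpha> \<beta>) \<longleftrightarrow> wf_formula \<alpha> \<and> wf_formula \<beta>"
| "wf_formula (Disj \<alpha> \<beta>) \<longleftrightarrow> wf_formula \<alpha> \<and> wf_formula \<beta>"
| "wf_formula (Impl \<alpha> \<beta>) \<longleftrightarrow> wf_formula \<alpha> \<and> wf_formula \<beta>"
| "wf_formula (Dia \<alpha>) \<longleftrightarrow> wf_formula \<alpha>"
| "wf_formula (Box \<alpha>) \<longleftrightarrow> wf_formula \<alpha>"
| "wf_formula (At s \<alpha>) \<longleftrightarrow> wf_formula \<alpha>"
| "wf_formula (Win l r \<alpha>) \<longleftrightarrow> l \<le> r \<and> wf_formula \<alpha>"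

primrec normal :: "'a formula \<Rightarrow> bool" where
  "normal (Atom a) \<longleftrightarrow> True"
| "normal (Neg \<alpha>) \<longleftrightarrow> False"
| "normal (Conj \<alpha> \<beta>) \<longleftrightarrow> normal \<alpha> \<and> normal \<beta>"
| "normal (Disj \<alpha> \<beta>) \<longleftrightarrow> False"
| "normal (Impl \<alpha> \<beta>) \<longleftrightarrow> False"
| "normal (Dia \<alpha>) \<longleftrightarrow> False"
| "normal (Box \<alpha>) \<longleftrightarrow> normal \<alpha>"
| "normal (At s \<alpha>) \<longleftrightarrow> normal \<alpha>"
| "normal (Win l r \<alpha>) \<longleftrightarrow> normal \<alpha>"

(* Inclusion, union and the empty stream are the pointwise \<le>, \<squnion> (sup) and bot
   of the function space. *)
type_synonym 'a stream = "time \<Rightarrow> 'a set"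

definition single :: "'a \<Rightarrow> time \<Rightarrow> 'a stream" where
  "single a s = (\<lambda>_. {})(s := {a})"

definition interval :: "time set \<Rightarrow> bool" where
  "interval A \<longleftrightarrow> (\<forall>u\<in>A. \<forall>v\<in>A. \<forall>s.
     nat_of_time u \<le> nat_of_time s \<and> nat_of_time s \<le> nat_of_time v \<longrightarrow> s \<in> A)"

definition supp :: "'a stream \<Rightarrow> time set" where
  "supp I = \<Inter>{A. interval A \<and> {s. I s \<noteq> {}} \<subseteq> A}"

(* The lower bound s - l \<le> u is written s \<le> u + l: subtraction on enat truncates. *)
definition window :: "'a stream \<Rightarrow> enat \<Rightarrow> enat \<Rightarrow> time \<Rightarrow> 'a stream" where
  "window I l r s = (\<lambda>u.
     if enat (nat_of_time s) \<le> enat (nat_of_time u) + l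
        \<and> enat (nat_of_time u) \<le> enat (nat_of_time s) + r
     then I u else {})"

primrec entails :: "'a \<Rightarrow> 'a set \<Rightarrow> 'a stream \<Rightarrow> time \<Rightarrow> 'a formula \<Rightarrow> bool" where
  "entails tp \<Gamma> I s (Atom a) \<longleftrightarrow> a = tp \<or> a \<in> I s \<union> \<Gamma>"
| "entails tp \<Gamma> I s (Neg \<alpha>) \<longleftrightarrow> \<not> entails tp \<Gamma> I s \<alpha>"
| "entails tp \<Gamma> I s (Conj \<alpha> \<beta>) \<longleftrightarrow> entails tp \<Gamma> I s \<alpha> \<and> entails tp \<Gamma> I s \<beta>"
| "entails tp \<Gamma> I s (Disj \<alpha> \<beta>) \<longleftrightarrow> entails tp \<Gamma> I s \<alpha> \<or> entails tp \<Gamma> I s \<beta>"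
| "entails tp \<Gamma> I s (Impl \<alpha> \<beta>) \<longleftrightarrow> (entails tp \<Gamma> I s \<alpha> \<longrightarrow> entails tp \<Gamma> I s \<beta>)"
| "entails tp \<Gamma> I s (Dia \<alpha>) \<longleftrightarrow> (\<exists>s'\<in>supp I. entails tp \<Gamma> I s' \<alpha>)"
| "entails tp \<Gamma> I s (Box \<alpha>) \<longleftrightarrow> (\<forall>s'\<in>supp I. entails tp \<Gamma> I s' \<alpha>)"
| "entails tp \<Gamma> I s (At s' \<alpha>) \<longleftrightarrow> entails tp \<Gamma> I s' \<alpha>"
| "entails tp \<Gamma> I s (Win l r \<alpha>) \<longleftrightarrow> entails tp \<Gamma> (window I l r s) s \<alpha>"

definition consistent :: "'a \<Rightarrow> 'a set \<Rightarrow> time \<Rightarrow> 'a formula \<Rightarrow> bool" where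
  "consistent tp \<Gamma> s \<alpha> \<longleftrightarrow> (\<exists>I. entails tp \<Gamma> I s \<alpha>)"

(* Atoms that hold in every stream contribute nothing to the partial model.  These are the
   atoms in \<Gamma> and tp, i.e. tp is read as a member of the background data, as in entails;
   for tp \<in> \<Gamma> the clause for atoms is just the case distinction on a \<in> \<Gamma>.  If it were
   single tp s for tp \<notin> \<Gamma>, then single tp t would be a Fitting answer stream of the program
   { tp \<leftarrow> tp } for empty data, but not an answer stream, since the empty stream is
   already a model of that program.
   Only normal formulas are in the domain of the operator. *)
primrec (nonexhaustive) partial_model ::
    "'a \<Rightarrow> 'a set \<Rightarrow> 'a stream \<Rightarrow> time \<Rightarrow> 'a formula \<Rightarrow> 'a stream" where
  "partial_model tp \<Gamma> I s (Atom a) = (if a = tp \<or> a \<in> \<Gamma> then bot else single a s)"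
| "partial_model tp \<Gamma> I s (Conj \<alpha> \<beta>) =
     sup (partial_model tp \<Gamma> I s \<alpha>) (partial_model tp \<Gamma> I s \<beta>)"
| "partial_model tp \<Gamma> I s (Box \<alpha>) = (SUP s'\<in>supp I. partial_model tp \<Gamma> I s' \<alpha>)"
| "partial_model tp \<Gamma> I s (At s' \<alpha>) = partial_model tp \<Gamma> I s' \<alpha>"
| "partial_model tp \<Gamma> I s (Win l r \<alpha>) = partial_model tp \<Gamma> (window I l r s) s \<alpha>"

definition partial_model_set ::
    "'a \<Rightarrow> 'a set \<Rightarrow> 'a stream \<Rightarrow> time \<Rightarrow> 'a formula set \<Rightarrow> 'a stream" where
  "partial_model_set tp \<Gamma> I s A = (SUP \<alpha>\<in>A. partial_model tp \<Gamma> I s \<alpha>)"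

definition model_operator ::
    "'a \<Rightarrow> 'a set \<Rightarrow> 'a stream \<Rightarrow> time \<Rightarrow> 'a formula set \<Rightarrow> 'a stream" where
  "model_operator tp \<Gamma> I s A = partial_model_set tp \<Gamma> (partial_model_set tp \<Gamma> I s A) s A"

(* Rule \<alpha> [b1,...,bj] [c1,...,cm] is the rule with head \<alpha>, positive body formulas b1,...,bj
   and default-negated body formulas c1,...,cm. *)
datatype 'a rule = Rule (head: "'a formula") (pos: "'a formula list") (neg: "'a formula list")

definition body :: "'a rule \<Rightarrow> 'a formula" where
  "body \<rho> = (let bs = pos \<rho> @ map Neg (neg \<rho>) in foldl Conj (hd bs) (tl bs))"

definition program :: "'a \<Rightarrow> 'a set \<Rightarrow> time \<Rightarrow> 'a rule set \<Rightarrow> bool" where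
  "program tp \<Gamma> t P \<longleftrightarrow> finite P \<and> P \<noteq> {} \<and>
     (\<forall>\<rho>\<in>P. wf_formula (head \<rho>) \<and> normal (head \<rho>) \<and> consistent tp \<Gamma> t (head \<rho>) \<and>
        pos \<rho> \<noteq> [] \<and> (\<forall>\<beta>\<in>set (pos \<rho>) \<union> set (neg \<rho>). wf_formula \<beta>))"

definition model ::
    "'a \<Rightarrow> 'a set \<Rightarrow> 'a rule set \<Rightarrow> 'a stream \<Rightarrow> time \<Rightarrow> 'a stream \<Rightarrow> bool" where
  "model tp \<Gamma> P D t I \<longleftrightarrow> D \<le> I \<and> (\<forall>\<rho>\<in>P. entails tp \<Gamma> I t (Impl (body \<rho>) (head \<rho>)))"

definition reduct ::
    "'a \<Rightarrow> 'a set \<Rightarrow> 'a rule set \<Rightarrow> 'a stream \<Rightarrow> time \<Rightarrow> 'a rule set" where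
  "reduct tp \<Gamma> P I t = {\<rho>\<in>P. entails tp \<Gamma> I t (body \<rho>)}"

definition answer_stream ::
    "'a \<Rightarrow> 'a set \<Rightarrow> 'a rule set \<Rightarrow> 'a stream \<Rightarrow> time \<Rightarrow> 'a stream \<Rightarrow> bool" where
  "answer_stream tp \<Gamma> P D t I \<longleftrightarrow> D \<le> I \<and> model tp \<Gamma> (reduct tp \<Gamma> P I t) D t I \<and>
     \<not> (\<exists>J. model tp \<Gamma> (reduct tp \<Gamma> P I t) D t J \<and> J < I)"

definition entails3 ::
    "'a \<Rightarrow> 'a set \<Rightarrow> 'a stream \<times> 'a stream \<Rightarrow> time \<Rightarrow> 'a formula \<Rightarrow> bool" where
  "entails3 tp \<Gamma> IJ t \<alpha> \<longleftrightarrow> (\<forall>K\<in>{fst IJ..snd IJ}. entails tp \<Gamma> K t \<alpha>)"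

definition fitting ::
    "'a \<Rightarrow> 'a set \<Rightarrow> 'a rule set \<Rightarrow> 'a stream \<Rightarrow> time \<Rightarrow> 'a stream \<times> 'a stream \<Rightarrow> 'a stream" where
  "fitting tp \<Gamma> P D t IJ =
     sup D (model_operator tp \<Gamma> (fst IJ) t {head \<rho> |\<rho>. \<rho> \<in> P \<and> entails3 tp \<Gamma> IJ t (body \<rho>)})"

definition fitting_lfp ::
    "'a \<Rightarrow> 'a set \<Rightarrow> 'a rule set \<Rightarrow> 'a stream \<Rightarrow> time \<Rightarrow> 'a stream \<Rightarrow> 'a stream" where
  "fitting_lfp tp \<Gamma> P D t I = (LEAST K. K \<le> I \<and> fitting tp \<Gamma> P D t (K, I) = K)"

definition fitting_answer_stream ::
    "'a \<Rightarrow> 'a set \<Rightarrow> 'a rule set \<Rightarrow> 'a stream \<Rightarrow> time \<Rightarrow> 'a stream \<Rightarrow> bool" where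
  "fitting_answer_stream tp \<Gamma> P D t I \<longleftrightarrow>
     model tp \<Gamma> P D t I \<and> fitting_lfp tp \<Gamma> P D t I = I"

end

(* Write F K for fitting tp \<Gamma> P D t (K, I).  If J \<le> I is a model of the reduct of P by I, then
   every rule whose body holds throughout [J, I] lies in the reduct and has its body, hence its
   head, true in J; and partial models of formulas true in J lie below J.  So J is a pre-fixed
   point of the monotone map F, and by Knaster-Tarski the least fixed point of F lies below J.
   If I is that fixed point, then J = I. *)

theory Submission
  imports Defs
begin

text \<open>Every interval covering the nonempty times of \<open>J\<close> also covers those of
  \<open>I\<close>, so \<open>supp J\<close> intersects a smaller family.\<close>

lemma supp_mono:
  assumes "I \<le> J"
  shows "supp I \<subseteq> supp J"
proof -
  have "{s. I s \<noteq> {}} \<subseteq> {s. J s \<noteq> {}}"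
    using assms by (auto simp: le_fun_def)
  then show ?thesis
    unfolding supp_def by (intro Inter_anti_mono) auto
qed

lemma window_mono: "I \<le> J \<Longrightarrow> window I l r s \<le> window J l r s"
  by (simp add: window_def le_fun_def)

lemma window_le: "window I l r s \<le> I"
  by (simp add: window_def le_fun_def)

text \<open>The stream enters only through supports and windows, both monotone; at a box, a larger
  support just adds time points to the union. Normality restricts to formulas for which
  \<open>partial_model\<close> has defining equations.\<close>

lemma partial_model_mono:
  assumes "normal \<alpha>" and "I \<le> J"
  shows "partial_model tp \<Gamma> I s \<alpha> \<le> partial_model tp \<Gamma> J s \<alpha>"
  using assms
proof (induction \<alpha> arbitrary: I J s)
  case (Conj \<alpha> \<beta>)
  then show ?case
    unfolding partial_model.simps by (intro sup_mono Conj.IH) simp_all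
next
  case (Box \<alpha>)
  then show ?case
    unfolding partial_model.simps by (intro SUP_subset_mono supp_mono Box.IH) simp_all
next
  case (Win l r \<alpha>)
  then show ?case by (simp add: window_mono)
qed simp_all

text \<open>An atom that contributes is neither \<open>tp\<close> nor in \<Gamma>, so its truth must
  come from \<open>I s\<close>. Windows change the stream, hence the generalisation over
  \<open>I\<close>; \<open>window_le\<close> leads back to \<open>I\<close>.\<close>

lemma partial_model_le:
  assumes "normal \<alpha>" and "entails tp \<Gamma> I s \<alpha>"
  shows "partial_model tp \<Gamma> I s \<alpha> \<le> I"
  using assms
proof (induction \<alpha> arbitrary: I s)
  case (Atom a)
  then show ?case by (auto simp: single_def le_fun_def)
next
  case (Box \<alpha>)
  then show ?case
    unfolding partial_model.simps by (intro SUP_least Box.IH) simp_all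
next
  case (Win l r \<alpha>)
  then show ?case
    using order_trans[OF Win.IH window_le] by simp
qed simp_all

lemma partial_model_set_mono:
  assumes "\<forall>\<alpha>\<in>B. normal \<alpha>" and "A \<subseteq> B" and "I \<le> J"
  shows "partial_model_set tp \<Gamma> I s A \<le> partial_model_set tp \<Gamma> J s B"
  unfolding partial_model_set_def
  using assms by (intro SUP_subset_mono partial_model_mono) auto

lemma partial_model_set_le:
  assumes "\<forall>\<alpha>\<in>A. normal \<alpha> \<and> entails tp \<Gamma> I s \<alpha>"
  shows "partial_model_set tp \<Gamma> I s A \<le> I"
  unfolding partial_model_set_def
  using assms by (intro SUP_least partial_model_le) auto

lemma model_operator_mono:
  assumes "\<forall>\<alpha>\<in>B. normal \<alpha>" and "A \<subseteq> B" and "I \<le> J"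
  shows "model_operator tp \<Gamma> I s A \<le> model_operator tp \<Gamma> J s B"
  unfolding model_operator_def
  using assms by (intro partial_model_set_mono)

lemma model_operator_le:
  assumes "\<forall>\<alpha>\<in>A. normal \<alpha> \<and> entails tp \<Gamma> I s \<alpha>"
  shows "model_operator tp \<Gamma> I s A \<le> I"
proof -
  have le: "partial_model_set tp \<Gamma> I s A \<le> I"
    using assms by (rule partial_model_set_le)
  \<comment> \<open>The outer evaluation uses the inner partial model as its stream; this lies below
    \<open>I\<close>, so monotonicity applies.\<close>
  have "model_operator tp \<Gamma> I s A \<le> partial_model_set tp \<Gamma> I s A"
    unfolding model_operator_def using assms le by (intro partial_model_set_mono) auto
  with le show ?thesis by (rule order_trans[rotated])
qed

lemma entails3_mono:
  assumes "K \<le> K'" and "entails3 tp \<Gamma> (K, I) t \<alpha>"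
  shows "entails3 tp \<Gamma> (K', I) t \<alpha>"
  using assms by (auto simp: entails3_def intro: order_trans)

text \<open>Raising \<open>K\<close> shrinks \<open>{K..I}\<close>, so more bodies hold throughout
  it, and it also raises the stream in which the heads are evaluated.\<close>

lemma mono_fitting:
  assumes "\<forall>\<rho>\<in>P. normal (head \<rho>)"
  shows "mono (\<lambda>K. fitting tp \<Gamma> P D t (K, I))"
proof (rule monoI)
  fix K K' :: "'a stream"
  assume "K \<le> K'"
  then show "fitting tp \<Gamma> P D t (K, I) \<le> fitting tp \<Gamma> P D t (K', I)"
    unfolding fitting_def fst_conv using assms
    by (intro sup_mono order_refl model_operator_mono) (auto intro: entails3_mono)
qed

text \<open>Both ends of \<open>{J..I}\<close> count: the body at \<open>I\<close> puts the rule
  into the reduct, and the body at \<open>J\<close> then yields the head at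
  \<open>J\<close>.\<close>

lemma fitting_le_model:
  assumes "\<forall>\<rho>\<in>P. normal (head \<rho>)"
    and "model tp \<Gamma> (reduct tp \<Gamma> P I t) D t J" and "J \<le> I"
  shows "fitting tp \<Gamma> P D t (J, I) \<le> J"
  unfolding fitting_def fst_conv
  using assms
  by (intro sup_least model_operator_le) (auto simp: model_def reduct_def entails3_def)

text \<open>\<open>lfp\<close> ranges over all streams, \<open>fitting_lfp\<close> only over those
  below \<open>I\<close>. The pre-fixed point \<open>J\<close> forces \<open>lfp\<close> below
  \<open>I\<close>, so the restriction changes nothing.\<close>

lemma fitting_lfp_eq_lfp:
  assumes "\<forall>\<rho>\<in>P. normal (head \<rho>)" and "fitting tp \<Gamma> P D t (J, I) \<le> J" and "J \<le> I"
  shows "fitting_lfp tp \<Gamma> P D t I = lfp (\<lambda>K. fitting tp \<Gamma> P D t (K, I))"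
  unfolding fitting_lfp_def
proof (rule Least_equality)
  let ?F = "\<lambda>K. fitting tp \<Gamma> P D t (K, I)"
  have "lfp ?F \<le> I"
    using lfp_lowerbound[of ?F, OF assms(2)] assms(3) by (rule order_trans)
  then show "lfp ?F \<le> I \<and> ?F (lfp ?F) = lfp ?F"
    using lfp_fixpoint[OF mono_fitting[OF assms(1)]] by blast
  show "lfp ?F \<le> K" if "K \<le> I \<and> ?F K = K" for K
    using that by (intro lfp_lowerbound) simp
qed

theorem theorem3:
  fixes tp :: "'a::finite" and \<Gamma> :: "'a set" and D I :: "'a stream"
    and t :: time and P :: "'a rule set"
  assumes "program tp \<Gamma> t P"
    and "fitting_answer_stream tp \<Gamma> P D t I"
  shows "answer_stream tp \<Gamma> P D t I"
proof -
  have normal: "\<forall>\<rho>\<in>P. normal (head \<rho>)"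
    using assms(1) by (simp add: program_def)
  have model: "model tp \<Gamma> P D t I" and lfp: "fitting_lfp tp \<Gamma> P D t I = I"
    using assms(2) by (simp_all add: fitting_answer_stream_def)
  have "\<not> J < I" if J: "model tp \<Gamma> (reduct tp \<Gamma> P I t) D t J" for J
  proof
    assume "J < I"
    then have "J \<le> I" by simp
    have prefixed: "fitting tp \<Gamma> P D t (J, I) \<le> J"
      using normal J \<open>J \<le> I\<close> by (rule fitting_le_model)
    have "I = lfp (\<lambda>K. fitting tp \<Gamma> P D t (K, I))"
      using fitting_lfp_eq_lfp[OF normal prefixed \<open>J \<le> I\<close>] lfp by simp
    also have "\<dots> \<le> J"
      by (rule lfp_lowerbound) (rule prefixed)
    finally show False
      using \<open>J < I\<close> by (simp add: less_le_not_le)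
  qed
  \<comment> \<open>\<open>I\<close> models the reduct because it models all of \<open>P\<close>, of
    which the reduct is a subset.\<close>
  with model show ?thesis
    by (auto simp: answer_stream_def model_def reduct_def)
qed

end
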